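(* Let $(\tau,s)\in\mathcal{D}$ and let the sequences $\{\mathbf{w}^k\}$ and $\{\widetilde{\mathbf{w}}^k\}$ be generated by GS-ADMM. Then there exists a constant $\xi>0$, not depending on $t$, such that for every integer $t>0$ $$\left\|M(\mathbf{w}^t-\widetilde{\mathbf{w}}^t)\right\|_H^2\leq \frac{1}{(t+1)\xi}\left\|\mathbf{w}^{0}-\mathbf{w}^*\right\|_H^2,\qquad \forall\, \mathbf{w}^*\in \mathcal{M}^*.$$
   Context: Problem. Let $p,q\ge 1$ be integers. Consider $$\min \sum_{i=1}^{p}f_i(x_i)+ \sum_{j=1}^{q}g_j(y_j)\quad \text{s.t. } \sum_{i=1}^{p}A_i x_i+\sum_{j=1}^{q}B_jy_j=c,\ x_i\in \mathcal{X}_i\ (i=1,\dots,p),\ y_j\in \mathcal{Y}_j\ (j=1,\dots,q),$$ where $f_i:\mathbb{R}^{m_i}\to\mathbb{R}$, $g_j:\mathbb{R}^{d_j}\to\mathbb{R}$ are closed proper convex functions (possibly nonsmooth), $A_i\in\mathbb{R}^{n\times m_i}$, $B_j\in\mathbb{R}^{n\times d_j}$, $c\in\mathbb{R}^n$, and $\mathcal{X}_i\subset\mathbb{R}^{m_i}$, $\mathcal{Y}_j\subset\mathbb{R}^{d_j}$ are polyhedra. Standing assumptions: the solution set of this problem is nonempty and all $A_i$, $B_j$ have full column rank. Notation. $\mathcal{A}=[A_1,\dots,A_p]$, $\mathcal{B}=[B_1,\dots,B_q]$, $\mathbf{x}=(x_1,\dots,x_p)$, $\mathbf{y}=(y_1,\dots,y_q)$,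 $\mathbf{u}=(\mathbf{x},\mathbf{y})$, $\mathbf{w}=(\mathbf{x},\mathbf{y},\lambda)$ with $\lambda\in\mathbb{R}^n$. $\mathcal{X}=\mathcal{X}_1\times\cdots\times\mathcal{X}_p$, $\mathcal{Y}=\mathcal{Y}_1\times\cdots\times\mathcal{Y}_q$, $\mathcal{M}=\mathcal{X}\times\mathcal{Y}\times\mathbb{R}^n$. $\|\cdot\|$ is the Euclidean norm; $\|x\|_G^2=x^{\sf T}Gx$ for symmetric $G$. For $\beta>0$, $$\mathcal{L}_\beta(\mathbf{x},\mathbf{y},\lambda)=\sum_{i}f_i(x_i)+\sum_j g_j(y_j)-\langle\lambda,\mathcal{A}\mathbf{x}+\mathcal{B}\mathbf{y}-c\rangle+\frac{\beta}{2}\|\mathcal{A}\mathbf{x}+\mathcal{B}\mathbf{y}-c\|^2 .$$ GS-ADMM. Parameters: $\beta>0$, $\sigma_1\in(p-1,+\infty)$, $\sigma_2\in(q-1,+\infty)$, and stepsizes $(\tau,s)\in\mathcal{D}:=\{(\tau,s)\mid \tau<1,\ s<1,\ \tau+s>0\}$. From an initial point $\mathbf{w}^0=(\mathbf{x}^0,\mathbf{y}^0,\lambda^0)$, for $k=0,1,2,\dots$: - $x_i^{k+1}=\arg\min_{x_i\in\mathcal{X}_i}\mathcal{L}_\beta(x_1^k,\dots,x_i,\dots,x_p^k,\mathbf{y}^k,\lambda^k)+\frac{\sigma_1\beta}{2}\|A_i(x_i-x_i^k)\|^2$, for $i=1,\dots,p$; - $\lambda^{k+\frac12}=\lambda^k-\tau\beta(\mathcal{A}\mathbf{x}^{k+1}+\mathcal{B}\mathbf{y}^k-c)$;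 - $y_j^{k+1}=\arg\min_{y_j\in\mathcal{Y}_j}\mathcal{L}_\beta(\mathbf{x}^{k+1},y_1^k,\dots,y_j,\dots,y_q^k,\lambda^{k+\frac12})+\frac{\sigma_2\beta}{2}\|B_j(y_j-y_j^k)\|^2$, for $j=1,\dots,q$; - $\lambda^{k+1}=\lambda^{k+\frac12}-s\beta(\mathcal{A}\mathbf{x}^{k+1}+\mathcal{B}\mathbf{y}^{k+1}-c)$. Put $\mathbf{w}^k=(\mathbf{x}^k,\mathbf{y}^k,\lambda^k)$ and $\widetilde{\mathbf{w}}^k=(\widetilde{\mathbf{x}}^k,\widetilde{\mathbf{y}}^k,\widetilde\lambda^k)$ with $\widetilde{\mathbf{x}}^k=\mathbf{x}^{k+1}$, $\widetilde{\mathbf{y}}^k=\mathbf{y}^{k+1}$, $\widetilde\lambda^k=\lambda^k-\beta(\mathcal{A}\mathbf{x}^{k+1}+\mathcal{B}\mathbf{y}^k-c)$. Matrices. $H_{\mathbf{x}}$ is the $p\times p$ block matrix with diagonal blocks $\sigma_1\beta A_i^{\sf T}A_i$ and off-diagonal $(i,l)$ blocks $-\beta A_i^{\sf T}A_l$. With $D_B=\mathrm{diag}(B_1^{\sf T}B_1,\dots,B_q^{\sf T}B_q)$ (block diagonal), $$Q=\begin{bmatrix}H_{\mathbf{x}}&\mathbf{0}&\mathbf{0}\\ \mathbf{0}&(\sigma_2+1)\beta D_B&-\tau\mathcal{B}^{\sf T}\\ \mathbf{0}&-\mathcal{B}&\frac1\beta I\end{bmatrix},\qquad M=\begin{bmatrix}I&\mathbf{0}&\mathbf{0}\\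 \mathbf{0}&I&\mathbf{0}\\ \mathbf{0}&-s\beta\mathcal{B}&(\tau+s)I\end{bmatrix},$$ the blocks corresponding to $\mathbf{x},\mathbf{y},\lambda$, and $H=QM^{-1}$ (which is symmetric positive definite for $(\tau,s)\in\mathcal{D}$). Solution set. With $h(\mathbf{u})=\sum_{i=1}^p f_i(x_i)+\sum_{j=1}^q g_j(y_j)$ and $\mathcal{J}(\mathbf{w})=(-\mathcal{A}^{\sf T}\lambda,\,-\mathcal{B}^{\sf T}\lambda,\,\mathcal{A}\mathbf{x}+\mathcal{B}\mathbf{y}-c)$, $$\mathcal{M}^*=\bigcap_{\mathbf{w}\in\mathcal{M}}\{\widehat{\mathbf{w}}\in\mathcal{M}\mid h(\mathbf{u})-h(\widehat{\mathbf{u}})+\langle\mathbf{w}-\widehat{\mathbf{w}},\mathcal{J}(\mathbf{w})\rangle\ge 0\}.$$ *)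

theory Defs
  imports "HOL-Analysis.Analysis"
begin

text \<open>
  Block vectors with blocks of different sizes.  A stacked vector x = (x_1, ..., x_p), with x_i in
  R^{m_i}, is an element of \<^typ>\<open>real ^ 'm\<close> together with a map b from the coordinates to
  the block indices: coordinate k belongs to block b k.  Thus p is the cardinality of the index
  type, and m_i = card {k. b k = i}, so that the sizes m_i are arbitrary (b need not be surjective:
  m_i = 0 is allowed).  R^{m_i} is represented by the coordinate subspace \<open>blk_space b i\<close>
  of the vectors that vanish outside block i.  Likewise a matrix with block columns
  [A_1, ..., A_p] is one matrix A with columns indexed by 'm, and A_i is represented by
  \<open>blk_cols b i A\<close>, which is A_i padded with zero columns; padding changes neither A_i x_i
  nor the rank.
\<close>

definition blk_space :: "('m::finite \<Rightarrow> 'p) \<Rightarrow> 'p \<Rightarrow> (real ^ 'm) set" where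
  "blk_space b i = {x. \<forall>k. b k \<noteq> i \<longrightarrow> x $ k = 0}"

definition blk_size :: "('m::finite \<Rightarrow> 'p) \<Rightarrow> 'p \<Rightarrow> nat" where
  "blk_size b i = card {k. b k = i}"

definition blk :: "('m::finite \<Rightarrow> 'p) \<Rightarrow> 'p \<Rightarrow> real ^ 'm \<Rightarrow> real ^ 'm" where
  "blk b i x = (\<chi> k. if b k = i then x $ k else 0)"

text \<open>\<open>blk_upd b i z x\<close> is (x_1, ..., x_{i-1}, z, x_{i+1}, ..., x_p).\<close>

definition blk_upd :: "('m::finite \<Rightarrow> 'p) \<Rightarrow> 'p \<Rightarrow> real ^ 'm \<Rightarrow> real ^ 'm \<Rightarrow> real ^ 'm" where
  "blk_upd b i z x = (\<chi> k. if b k = i then z $ k else x $ k)"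

definition blk_cols :: "('m::finite \<Rightarrow> 'p) \<Rightarrow> 'p \<Rightarrow> real ^ 'm ^ 'n \<Rightarrow> real ^ 'm ^ 'n" where
  "blk_cols b i A = (\<chi> r k. if b k = i then A $ r $ k else 0)"

definition blk_prod :: "('m::finite \<Rightarrow> 'p) \<Rightarrow> ('p \<Rightarrow> (real ^ 'm) set) \<Rightarrow> (real ^ 'm) set" where
  "blk_prod b X = {x. \<forall>i. blk b i x \<in> X i}"

definition sep_sum :: "('m::finite \<Rightarrow> 'p::finite) \<Rightarrow> ('p \<Rightarrow> real ^ 'm \<Rightarrow> real) \<Rightarrow> real ^ 'm \<Rightarrow> real" where
  "sep_sum b f x = (\<Sum>i\<in>UNIV. f i (blk b i x))"

lemma blk_cols_blk_sum:
  fixes b :: "'m::finite \<Rightarrow> 'p::finite" and A :: "real ^ 'm ^ 'n::finite"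
  shows "A *v x = (\<Sum>i\<in>UNIV. blk_cols b i A *v blk b i x)"
proof -
  have "(\<Sum>i\<in>(UNIV :: 'p set). (blk_cols b i A *v blk b i x) $ r) = (A *v x) $ r" for r
  proof -
    have "(\<Sum>i\<in>(UNIV :: 'p set). (blk_cols b i A *v blk b i x) $ r)
        = (\<Sum>i\<in>(UNIV :: 'p set). \<Sum>k\<in>UNIV. if b k = i then A $ r $ k * x $ k else 0)"
      unfolding matrix_vector_mult_def blk_cols_def blk_def
      by (intro sum.cong refl) (auto intro!: sum.cong)
    also have "\<dots> = (\<Sum>k\<in>UNIV. A $ r $ k * x $ k)"
      by (subst sum.swap) simp
    finally show ?thesis by (simp add: matrix_vector_mult_def)
  qed
  then show ?thesis by (simp add: vec_eq_iff)
qed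

text \<open>A closed proper convex function on the subspace S; properness is automatic, since f is
  finite-valued and S is nonempty.\<close>

definition closed_proper_convex_on :: "'a::euclidean_space set \<Rightarrow> ('a \<Rightarrow> real) \<Rightarrow> bool" where
  "closed_proper_convex_on S f \<longleftrightarrow> S \<noteq> {} \<and> convex_on S f \<and> closed (epigraph S f)"

definition feasible :: "('m::finite \<Rightarrow> 'p) \<Rightarrow> ('d::finite \<Rightarrow> 'q) \<Rightarrow>
    real ^ 'm ^ 'n::finite \<Rightarrow> real ^ 'd ^ 'n \<Rightarrow> real ^ 'n \<Rightarrow>
    ('p \<Rightarrow> (real ^ 'm) set) \<Rightarrow> ('q \<Rightarrow> (real ^ 'd) set) \<Rightarrow> real ^ 'm \<Rightarrow> real ^ 'd \<Rightarrow> bool" where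
  "feasible bx cy A B c X Y x y \<longleftrightarrow>
     A *v x + B *v y = c \<and> x \<in> blk_prod bx X \<and> y \<in> blk_prod cy Y"

definition solution_set :: "('m::finite \<Rightarrow> 'p::finite) \<Rightarrow> ('d::finite \<Rightarrow> 'q::finite) \<Rightarrow>
    ('p \<Rightarrow> real ^ 'm \<Rightarrow> real) \<Rightarrow> ('q \<Rightarrow> real ^ 'd \<Rightarrow> real) \<Rightarrow>
    real ^ 'm ^ 'n::finite \<Rightarrow> real ^ 'd ^ 'n \<Rightarrow> real ^ 'n \<Rightarrow>
    ('p \<Rightarrow> (real ^ 'm) set) \<Rightarrow> ('q \<Rightarrow> (real ^ 'd) set) \<Rightarrow> ((real ^ 'm) \<times> (real ^ 'd)) set" where
  "solution_set bx cy f g A B c X Y =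
     {u. is_arg_min (\<lambda>(x, y). sep_sum bx f x + sep_sum cy g y)
           (\<lambda>(x, y). feasible bx cy A B c X Y x y) u}"

definition aug_lagr :: "('m::finite \<Rightarrow> 'p::finite) \<Rightarrow> ('d::finite \<Rightarrow> 'q::finite) \<Rightarrow>
    ('p \<Rightarrow> real ^ 'm \<Rightarrow> real) \<Rightarrow> ('q \<Rightarrow> real ^ 'd \<Rightarrow> real) \<Rightarrow>
    real ^ 'm ^ 'n::finite \<Rightarrow> real ^ 'd ^ 'n \<Rightarrow> real ^ 'n \<Rightarrow> real \<Rightarrow>
    real ^ 'm \<Rightarrow> real ^ 'd \<Rightarrow> real ^ 'n \<Rightarrow> real" where
  "aug_lagr bx cy f g A B c \<beta> x y l =
     sep_sum bx f x + sep_sum cy g y - l \<bullet> (A *v x + B *v y - c)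
       + \<beta> / 2 * (norm (A *v x + B *v y - c))\<^sup>2"

text \<open>The sequence \<open>lh k\<close> is the intermediate multiplier with index k + 1/2.\<close>

definition gs_admm :: "('m::finite \<Rightarrow> 'p::finite) \<Rightarrow> ('d::finite \<Rightarrow> 'q::finite) \<Rightarrow>
    ('p \<Rightarrow> real ^ 'm \<Rightarrow> real) \<Rightarrow> ('q \<Rightarrow> real ^ 'd \<Rightarrow> real) \<Rightarrow>
    real ^ 'm ^ 'n::finite \<Rightarrow> real ^ 'd ^ 'n \<Rightarrow> real ^ 'n \<Rightarrow>
    ('p \<Rightarrow> (real ^ 'm) set) \<Rightarrow> ('q \<Rightarrow> (real ^ 'd) set) \<Rightarrow>
    real \<Rightarrow> real \<Rightarrow> real \<Rightarrow> real \<Rightarrow> real \<Rightarrow>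
    (nat \<Rightarrow> real ^ 'm) \<Rightarrow> (nat \<Rightarrow> real ^ 'd) \<Rightarrow> (nat \<Rightarrow> real ^ 'n) \<Rightarrow> (nat \<Rightarrow> real ^ 'n) \<Rightarrow> bool" where
  "gs_admm bx cy f g A B c X Y \<beta> \<sigma>\<^sub>1 \<sigma>\<^sub>2 \<tau> s x y lh l \<longleftrightarrow>
     (\<forall>k.
       (\<forall>i. is_arg_min
              (\<lambda>z. aug_lagr bx cy f g A B c \<beta> (blk_upd bx i z (x k)) (y k) (l k)
                   + \<sigma>\<^sub>1 * \<beta> / 2 * (norm (blk_cols bx i A *v (z - blk bx i (x k))))\<^sup>2)
              (\<lambda>z. z \<in> X i)
              (blk bx i (x (Suc k)))) \<and>
       lh k = l k - (\<tau> * \<beta>) *\<^sub>R (A *v x (Suc k) + B *v y k - c) \<and>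
       (\<forall>j. is_arg_min
              (\<lambda>z. aug_lagr bx cy f g A B c \<beta> (x (Suc k)) (blk_upd cy j z (y k)) (lh k)
                   + \<sigma>\<^sub>2 * \<beta> / 2 * (norm (blk_cols cy j B *v (z - blk cy j (y k))))\<^sup>2)
              (\<lambda>z. z \<in> Y j)
              (blk cy j (y (Suc k)))) \<and>
       l (Suc k) = lh k - (s * \<beta>) *\<^sub>R (A *v x (Suc k) + B *v y (Suc k) - c))"

text \<open>The vectors w = (x, y, \<open>\<lambda>\<close>) are indexed by the disjoint sum of the three coordinate types.\<close>

definition stack :: "real ^ 'm::finite \<Rightarrow> real ^ 'd::finite \<Rightarrow> real ^ 'n::finite \<Rightarrow> real ^ ('m + 'd + 'n)" where
  "stack x y l = (\<chi> k. case k of Inl a \<Rightarrow> x $ a | Inr (Inl a) \<Rightarrow> y $ a | Inr (Inr a) \<Rightarrow> l $ a)"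

definition xpart :: "real ^ ('m::finite + 'd::finite + 'n::finite) \<Rightarrow> real ^ 'm" where
  "xpart w = (\<chi> a. w $ Inl a)"

definition ypart :: "real ^ ('m::finite + 'd::finite + 'n::finite) \<Rightarrow> real ^ 'd" where
  "ypart w = (\<chi> a. w $ Inr (Inl a))"

definition lpart :: "real ^ ('m::finite + 'd::finite + 'n::finite) \<Rightarrow> real ^ 'n" where
  "lpart w = (\<chi> a. w $ Inr (Inr a))"

definition block3 ::
  "real ^ 'm ^ 'm \<Rightarrow> real ^ 'd ^ 'm \<Rightarrow> real ^ 'n ^ 'm \<Rightarrow>
   real ^ 'm ^ 'd \<Rightarrow> real ^ 'd ^ 'd \<Rightarrow> real ^ 'n ^ 'd \<Rightarrow>
   real ^ 'm ^ 'n \<Rightarrow> real ^ 'd ^ 'n \<Rightarrow> real ^ 'n ^ 'n \<Rightarrow>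
   real ^ ('m::finite + 'd::finite + 'n::finite) ^ ('m + 'd + 'n)" where
  "block3 P11 P12 P13 P21 P22 P23 P31 P32 P33 =
     (\<chi> r. case r of
        Inl a \<Rightarrow> stack (P11 $ a) (P12 $ a) (P13 $ a)
      | Inr (Inl a) \<Rightarrow> stack (P21 $ a) (P22 $ a) (P23 $ a)
      | Inr (Inr a) \<Rightarrow> stack (P31 $ a) (P32 $ a) (P33 $ a))"

text \<open>With zero-padded blocks, transpose A_i times A_l is the (i,l) block in its place with zeros
  elsewhere, so a block matrix is the sum of its blocks.\<close>

definition Hx :: "('m::finite \<Rightarrow> 'p::finite) \<Rightarrow> real ^ 'm ^ 'n::finite \<Rightarrow> real \<Rightarrow> real \<Rightarrow> real ^ 'm ^ 'm" where
  "Hx bx A \<beta> \<sigma>\<^sub>1 =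
     (\<Sum>i\<in>UNIV. \<Sum>l\<in>UNIV.
        (if i = l then \<sigma>\<^sub>1 * \<beta> else - \<beta>) *\<^sub>R (transpose (blk_cols bx i A) ** blk_cols bx l A))"

definition DB :: "('d::finite \<Rightarrow> 'q::finite) \<Rightarrow> real ^ 'd ^ 'n::finite \<Rightarrow> real ^ 'd ^ 'd" where
  "DB cy B = (\<Sum>j\<in>UNIV. transpose (blk_cols cy j B) ** blk_cols cy j B)"

definition Qmat :: "('m::finite \<Rightarrow> 'p::finite) \<Rightarrow> ('d::finite \<Rightarrow> 'q::finite) \<Rightarrow>
    real ^ 'm ^ 'n::finite \<Rightarrow> real ^ 'd ^ 'n \<Rightarrow> real \<Rightarrow> real \<Rightarrow> real \<Rightarrow> real \<Rightarrow>
    real ^ ('m + 'd + 'n) ^ ('m + 'd + 'n)" where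
  "Qmat bx cy A B \<beta> \<sigma>\<^sub>1 \<sigma>\<^sub>2 \<tau> =
     block3 (Hx bx A \<beta> \<sigma>\<^sub>1)  0                              0
            0               (((\<sigma>\<^sub>2 + 1) * \<beta>) *\<^sub>R DB cy B)   (- (\<tau> *\<^sub>R transpose B))
            0               (- B)                          (mat (1 / \<beta>))"

definition Mmat :: "real ^ 'd::finite ^ 'n::finite \<Rightarrow> real \<Rightarrow> real \<Rightarrow> real \<Rightarrow>
    real ^ ('m::finite + 'd + 'n) ^ ('m + 'd + 'n)" where
  "Mmat B \<beta> \<tau> s =
     block3 (mat 1)  0                        0
            0        (mat 1)                  0
            0        (- ((s * \<beta>) *\<^sub>R B))    (mat (\<tau> + s))"

definition Hmat :: "('m::finite \<Rightarrow> 'p::finite) \<Rightarrow> ('d::finite \<Rightarrow> 'q::finite) \<Rightarrow>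
    real ^ 'm ^ 'n::finite \<Rightarrow> real ^ 'd ^ 'n \<Rightarrow> real \<Rightarrow> real \<Rightarrow> real \<Rightarrow> real \<Rightarrow> real \<Rightarrow>
    real ^ ('m + 'd + 'n) ^ ('m + 'd + 'n)" where
  "Hmat bx cy A B \<beta> \<sigma>\<^sub>1 \<sigma>\<^sub>2 \<tau> s = Qmat bx cy A B \<beta> \<sigma>\<^sub>1 \<sigma>\<^sub>2 \<tau> ** matrix_inv (Mmat B \<beta> \<tau> s)"

text \<open>The squared norm \<open>\<parallel>v\<parallel>\<close>_G^2.\<close>

definition sqnorm :: "real ^ 'k ^ 'k \<Rightarrow> real ^ 'k::finite \<Rightarrow> real" where
  "sqnorm G v = v \<bullet> (G *v v)"

definition Mset :: "('m::finite \<Rightarrow> 'p) \<Rightarrow> ('d::finite \<Rightarrow> 'q) \<Rightarrow>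
    ('p \<Rightarrow> (real ^ 'm) set) \<Rightarrow> ('q \<Rightarrow> (real ^ 'd) set) \<Rightarrow> (real ^ ('m + 'd + 'n::finite)) set" where
  "Mset bx cy X Y = {w. xpart w \<in> blk_prod bx X \<and> ypart w \<in> blk_prod cy Y}"

definition Jmap :: "real ^ 'm::finite ^ 'n::finite \<Rightarrow> real ^ 'd::finite ^ 'n \<Rightarrow> real ^ 'n \<Rightarrow>
    real ^ ('m + 'd + 'n) \<Rightarrow> real ^ ('m + 'd + 'n)" where
  "Jmap A B c w =
     stack (- (transpose A *v lpart w)) (- (transpose B *v lpart w)) (A *v xpart w + B *v ypart w - c)"

definition hfun :: "('m::finite \<Rightarrow> 'p::finite) \<Rightarrow> ('d::finite \<Rightarrow> 'q::finite) \<Rightarrow>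
    ('p \<Rightarrow> real ^ 'm \<Rightarrow> real) \<Rightarrow> ('q \<Rightarrow> real ^ 'd \<Rightarrow> real) \<Rightarrow> real ^ ('m + 'd + 'n::finite) \<Rightarrow> real" where
  "hfun bx cy f g w = sep_sum bx f (xpart w) + sep_sum cy g (ypart w)"

definition Mstar :: "('m::finite \<Rightarrow> 'p::finite) \<Rightarrow> ('d::finite \<Rightarrow> 'q::finite) \<Rightarrow>
    ('p \<Rightarrow> real ^ 'm \<Rightarrow> real) \<Rightarrow> ('q \<Rightarrow> real ^ 'd \<Rightarrow> real) \<Rightarrow>
    real ^ 'm ^ 'n::finite \<Rightarrow> real ^ 'd ^ 'n \<Rightarrow> real ^ 'n \<Rightarrow>
    ('p \<Rightarrow> (real ^ 'm) set) \<Rightarrow> ('q \<Rightarrow> (real ^ 'd) set) \<Rightarrow> (real ^ ('m + 'd + 'n)) set" where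
  "Mstar bx cy f g A B c X Y =
     (\<Inter>w\<in>Mset bx cy X Y.
        {v \<in> Mset bx cy X Y. hfun bx cy f g w - hfun bx cy f g v + (w - v) \<bullet> Jmap A B c w \<ge> 0})"

end

theory Submission
  imports Defs
begin

text \<open>
  GS-ADMM is a prediction-correction method for a mixed variational inequality.  The optimality
  conditions of the subproblems say that the predictor \<open>wt k\<close> satisfies
  \<open>h v - h (wt k) + \<langle>v - wt k, J (wt k)\<rangle> \<ge> \<langle>v - wt k, Q (w k - wt k)\<rangle>\<close>
  for all \<open>v\<close>, and the iteration itself reads \<open>w (k + 1) = w k - M (w k - wt k)\<close>, where
  \<open>Q = H M\<close>.  Put \<open>G = Q\<^sup>T + Q - M\<^sup>T H M\<close>.  Testing the inequality at a solution shows
  that the squared H-distance to the solution drops by at least the G-norm of \<open>w k - wt k\<close>;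
  testing two consecutive inequalities against each other shows that the H-norm of
  \<open>M (w k - wt k)\<close> is nonincreasing.  Since \<open>G \<ge> \<xi> M\<^sup>T H M\<close> for some \<open>\<xi> > 0\<close>,
  telescoping gives the rate.  The bounds on the two proximal parameters enter through
  \<open>\<parallel>B y\<parallel>\<^sup>2 \<le> q (\<parallel>B\<^sub>1 y\<^sub>1\<parallel>\<^sup>2 + \<dots> + \<parallel>B\<^sub>q y\<^sub>q\<parallel>\<^sup>2)\<close> and its analogue for A.
\<close>

section \<open>The prediction-correction scheme\<close>

lemma matrix_inv:
  assumes "invertible A"
  shows matrix_inv_right: "A ** matrix_inv A = mat 1" and matrix_inv_left: "matrix_inv A ** A = mat 1"
  using someI_ex[OF assms[unfolded invertible_def]] by (simp_all add: matrix_inv_def)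

text \<open>The hypotheses speak of \<open>(M *v u) \<bullet> (Q *v v)\<close>, which is the H-inner
  product of \<open>M *v u\<close> and \<open>M *v v\<close> because H M = Q. An instance therefore
  never has to compute the inverse of \<open>M\<close>.\<close>

lemma prediction_correction_rate:
  fixes Q M :: "real ^ 'k ^ 'k::finite" and w wt :: "nat \<Rightarrow> real ^ 'k"
  defines "H \<equiv> Q ** matrix_inv M"
  assumes inv: "invertible M"
    and sym: "\<And>u v. (M *v u) \<bullet> (Q *v v) = (M *v v) \<bullet> (Q *v u)"
    and psd: "\<And>u. 0 \<le> (M *v u) \<bullet> (Q *v u)"
    and xi: "\<xi> > 0"
    and G: "\<And>u. \<xi> * ((M *v u) \<bullet> (Q *v u)) \<le> 2 * (u \<bullet> (Q *v u)) - (M *v u) \<bullet> (Q *v u)"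
    and J: "\<And>u v. (u - v) \<bullet> (J u - J v) = 0"
    and pred: "\<And>k v. v \<in> S \<Longrightarrow>
        h v - h (wt k) + (v - wt k) \<bullet> J (wt k) \<ge> (v - wt k) \<bullet> (Q *v (w k - wt k))"
    and wt: "\<And>k. wt k \<in> S"
    and step: "\<And>k. w (Suc k) = w k - M *v (w k - wt k)"
    and ws: "ws \<in> S" "\<And>v. v \<in> S \<Longrightarrow> h v - h ws + (v - ws) \<bullet> J v \<ge> 0"
  shows "sqnorm H (M *v (w t - wt t)) \<le> 1 / ((real t + 1) * \<xi>) * sqnorm H (w 0 - ws)"
proof -
  define d where "d k = w k - wt k" for k
  define N where "N u = (M *v u) \<bullet> (Q *v u)" for u
  have HM: "H *v (M *v v) = Q *v v" for v
    using inv by (simp add: H_def matrix_vector_mul_assoc matrix_mul_assoc[symmetric] matrix_inv_left)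
  \<comment> \<open>Every vector is an image under \<open>M\<close>, so symmetry and
    semidefiniteness of H can be read off the form in M u and M v.\<close>
  have surj: "\<exists>u. a = M *v u" for a
    using matrix_inv_right[OF inv]
    by (intro exI[of _ "matrix_inv M *v a"]) (simp add: matrix_vector_mul_assoc)
  have Hsym: "a \<bullet> (H *v b) = b \<bullet> (H *v a)" for a b
    using surj[of a] surj[of b] sym by (auto simp: HM)
  have Hpsd: "0 \<le> sqnorm H a" for a
    using surj[of a] psd by (auto simp: sqnorm_def HM)
  have HN: "sqnorm H (M *v v) = N v" for v
    by (simp add: sqnorm_def HM N_def)
  have sq_diff: "sqnorm H (a - b) = sqnorm H a - 2 * (a \<bullet> (H *v b)) + sqnorm H b" for a b
    using Hsym[of a b] by (simp add: sqnorm_def inner_diff matrix_vector_mult_diff_distrib)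
  have fejer: "sqnorm H (w (Suc k) - ws) \<le> sqnorm H (w k - ws) - \<xi> * N (d k)" for k
  proof -
    have "(ws - wt k) \<bullet> (Q *v d k) \<le> h ws - h (wt k) + (ws - wt k) \<bullet> J (wt k)"
      using pred[OF ws(1), of k] by (simp add: d_def)
    \<comment> \<open>The solution inequality is of Minty type, with \<open>J\<close> taken at the
      test point. At \<open>wt k\<close> it therefore involves the same \<open>J (wt k)\<close> as
      the prediction inequality tested at \<open>ws\<close>.\<close>
    also have "\<dots> \<le> 0"
      using ws(2)[OF wt[of k]] by (simp add: inner_diff_left)
    finally have "0 \<le> (wt k - ws) \<bullet> (Q *v d k)"
      by (simp add: inner_diff_left)
    then have "d k \<bullet> (Q *v d k) \<le> (w k - ws) \<bullet> (Q *v d k)"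
      by (simp add: d_def inner_diff_left)
    moreover have "w (Suc k) - ws = (w k - ws) - M *v d k"
      by (simp add: step d_def)
    then have "sqnorm H (w (Suc k) - ws) = sqnorm H (w k - ws) - 2 * ((w k - ws) \<bullet> (Q *v d k)) + N (d k)"
      using sq_diff[of "w k - ws" "M *v d k"] by (simp only: HM HN)
    ultimately show ?thesis
      using G[of "d k"] by (simp add: N_def)
  qed
  have mono: "N (d (Suc k)) \<le> N (d k)" for k
  proof -
    define e where "e = d k - d (Suc k)"
    \<comment> \<open>Each of the two inequalities is tested at the other predictor; the values of
      \<open>h\<close> cancel in the sum, and skewness of \<open>J\<close> removes the rest.\<close>
    have "(wt (Suc k) - wt k) \<bullet> (Q *v d k) + (wt k - wt (Suc k)) \<bullet> (Q *v d (Suc k))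
        \<le> (wt (Suc k) - wt k) \<bullet> J (wt k) + (wt k - wt (Suc k)) \<bullet> J (wt (Suc k))"
      using pred[OF wt[of "Suc k"], of k] pred[OF wt[of k], of "Suc k"] by (simp add: d_def)
    also have "\<dots> = 0"
      using J[of "wt k" "wt (Suc k)"] by (simp add: inner_diff algebra_simps)
    finally have "(wt (Suc k) - wt k) \<bullet> (Q *v e) \<le> 0"
      by (simp add: e_def matrix_vector_mult_diff_distrib inner_diff algebra_simps)
    \<comment> \<open>Since wt = w - d, the increment of wt is the correction step plus e. Hence 2
      <M d, Q e> is at least 2 <e, Q e>, which by \<open>G\<close> is at least N e, so N cannot
      increase.\<close>
    moreover have "wt (Suc k) - wt k = e - M *v d k"
      by (simp add: e_def d_def step)
    ultimately have "e \<bullet> (Q *v e) \<le> (M *v d k) \<bullet> (Q *v e)"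
      by (simp add: inner_diff_left)
    moreover have "N (d (Suc k)) = N (d k) - 2 * ((M *v d k) \<bullet> (Q *v e)) + N e"
    proof -
      have "d (Suc k) = d k - e" by (simp add: e_def)
      then show ?thesis
        by (simp add: HN[symmetric] matrix_vector_mult_diff_distrib sq_diff HM)
    qed
    moreover have "0 \<le> \<xi> * N e"
      using psd[of e] xi by (simp add: N_def)
    ultimately show ?thesis
      using G[of e] by (simp add: N_def)
  qed
  have "(\<Sum>k\<le>t. \<xi> * N (d k)) \<le> sqnorm H (w 0 - ws) - sqnorm H (w (Suc t) - ws)"
  proof (induction t)
    case 0
    show ?case using fejer[of 0] by simp
  next
    case (Suc t)
    then show ?case using fejer[of "Suc t"] by simp
  qed
  also have "\<dots> \<le> sqnorm H (w 0 - ws)"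
    using Hpsd by simp
  finally have sum: "(\<Sum>k\<le>t. \<xi> * N (d k)) \<le> sqnorm H (w 0 - ws)" .
  \<comment> \<open>The last of the t + 1 summands is the smallest, which produces the factor t +
    1.\<close>
  have "antimono (\<lambda>k. N (d k))"
    using mono by (simp add: decseq_Suc_iff)
  then have "(\<Sum>k\<le>t. \<xi> * N (d t)) \<le> (\<Sum>k\<le>t. \<xi> * N (d k))"
    using xi by (intro sum_mono) (auto simp: antimono_def)
  with sum have "(real t + 1) * \<xi> * N (d t) \<le> sqnorm H (w 0 - ws)"
    by (simp add: algebra_simps)
  then show ?thesis
    using xi by (simp add: HN d_def[symmetric] pos_le_divide_eq mult.commute)
qed

section \<open>Block vectors\<close>

lemma matrix_vector_mult_sum_left:
  fixes A :: "'i \<Rightarrow> real ^ 'm::finite ^ 'n::finite"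
  shows "(\<Sum>i\<in>I. A i) *v x = (\<Sum>i\<in>I. A i *v x)"
  by (induction I rule: infinite_finite_induct) (simp_all add: matrix_vector_mult_add_rdistrib)

lemma blk_cols_mult_blk: "blk_cols b i A *v blk b i x = blk_cols b i A *v x"
  by (auto simp: vec_eq_iff matrix_vector_mult_def blk_cols_def blk_def intro!: sum.cong)

lemma matrix_mult_blk: "A *v blk b i x = blk_cols b i A *v x"
  by (auto simp: vec_eq_iff matrix_vector_mult_def blk_cols_def blk_def intro!: sum.cong)

lemma blk_cols_sum:
  fixes b :: "'m::finite \<Rightarrow> 'p::finite" and A :: "real ^ 'm ^ 'n::finite"
  shows "A *v x = (\<Sum>i\<in>UNIV. blk_cols b i A *v x)"
  by (simp add: blk_cols_blk_sum[of A x b] blk_cols_mult_blk)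

lemma blk_upd_eq: "z \<in> blk_space b i \<Longrightarrow> blk_upd b i z x = x + (z - blk b i x)"
  by (auto simp: vec_eq_iff blk_upd_def blk_def blk_space_def)

lemma blk_blk_upd: "z \<in> blk_space b i \<Longrightarrow> blk b j (blk_upd b i z x) = (if j = i then z else blk b j x)"
  by (auto simp: vec_eq_iff blk_upd_def blk_def blk_space_def)

lemma sep_sum_blk_upd:
  assumes "z \<in> blk_space b i"
  shows "sep_sum b f (blk_upd b i z x) = f i z + (\<Sum>j\<in>UNIV - {i}. f j (blk b j x))"
  unfolding sep_sum_def
  by (subst sum.remove[of _ i]) (simp_all add: blk_blk_upd[OF assms])

text \<open>The bilinear form of the block diagonal matrix diag(A_i^T A_i): it is the form of
  \<open>DB\<close> for the y-blocks and the block diagonal ingredient of \<open>Hx\<close> for the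
  x-blocks.\<close>

definition blk_inner :: "('m::finite \<Rightarrow> 'p::finite) \<Rightarrow> real ^ 'm ^ 'n::finite \<Rightarrow> real ^ 'm \<Rightarrow> real ^ 'm \<Rightarrow> real"
  where "blk_inner b A u v = (\<Sum>i\<in>UNIV. (blk_cols b i A *v u) \<bullet> (blk_cols b i A *v v))"

lemma blk_inner_commute: "blk_inner b A u v = blk_inner b A v u"
  by (simp add: blk_inner_def inner_commute)

lemma blk_inner_nonneg: "0 \<le> blk_inner b A u u"
  by (simp add: blk_inner_def sum_nonneg)

text \<open>Triangle inequality over the blocks, then Cauchy-Schwarz against the all-ones vector,
  whose squared norm is the number of blocks.\<close>

lemma norm_matrix_le_blk_inner:
  fixes b :: "'m::finite \<Rightarrow> 'p::finite" and A :: "real ^ 'm ^ 'n::finite"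
  shows "(A *v u) \<bullet> (A *v u) \<le> real CARD('p) * blk_inner b A u u"
proof -
  have "norm (A *v u) \<le> (\<Sum>i\<in>(UNIV :: 'p set). norm (blk_cols b i A *v u))"
    unfolding blk_cols_sum[of A u b] by (rule norm_sum)
  then have "(norm (A *v u))\<^sup>2 \<le> (\<Sum>i\<in>(UNIV :: 'p set). norm (blk_cols b i A *v u))\<^sup>2"
    by (intro power_mono) auto
  also have "\<dots> \<le> real CARD('p) * (\<Sum>i\<in>(UNIV :: 'p set). (norm (blk_cols b i A *v u))\<^sup>2)"
    using Cauchy_Schwarz_ineq_sum[of "\<lambda>_. 1" "\<lambda>i. norm (blk_cols b i A *v u)" "UNIV :: 'p set"]
    by simp
  finally show ?thesis
    by (simp add: blk_inner_def power2_norm_eq_inner)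
qed

lemma inner_vector_matrix_mult:
  fixes B :: "real ^ 'm::finite ^ 'n::finite"
  shows "u \<bullet> (e v* B) = (B *v u) \<bullet> e"
  by (metis dot_lmul_matrix inner_commute)

lemma inner_transpose_mult:
  fixes A :: "real ^ 'm::finite ^ 'n::finite" and B :: "real ^ 'k::finite ^ 'n"
  shows "u \<bullet> ((transpose A ** B) *v v) = (A *v u) \<bullet> (B *v v)"
  by (simp add: matrix_vector_mul_assoc[symmetric] inner_vector_matrix_mult inner_commute)

lemma inner_DB: "u \<bullet> (DB b B *v v) = blk_inner b B u v"
  by (simp add: DB_def blk_inner_def matrix_vector_mult_sum_left inner_sum_right inner_transpose_mult)

text \<open>Writing the diagonal coefficient \<open>\<sigma> * \<beta>\<close> as
  \<open>(\<sigma> + 1) * \<beta> - \<beta>\<close> makes the coefficient of every block -\<beta>,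
  and these blocks add up to -\<beta> A^T A.\<close>

lemma inner_Hx:
  fixes b :: "'m::finite \<Rightarrow> 'p::finite" and A :: "real ^ 'm ^ 'n::finite"
  shows "u \<bullet> (Hx b A \<beta> \<sigma> *v v) = (\<sigma> + 1) * \<beta> * blk_inner b A u v - \<beta> * ((A *v u) \<bullet> (A *v v))"
proof -
  let ?a = "\<lambda>i l. (blk_cols b i A *v u) \<bullet> (blk_cols b l A *v v)"
  have "u \<bullet> (Hx b A \<beta> \<sigma> *v v) = (\<Sum>i\<in>(UNIV :: 'p set). \<Sum>l\<in>UNIV. (if i = l then \<sigma> * \<beta> else - \<beta>) * ?a i l)"
    by (simp add: Hx_def matrix_vector_mult_sum_left inner_sum_right scaleR_matrix_vector_assoc[symmetric]
        inner_transpose_mult)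
  also have "\<dots> = (\<Sum>i\<in>(UNIV :: 'p set). \<Sum>l\<in>UNIV. (if i = l then (\<sigma> + 1) * \<beta> * ?a i l else 0) - \<beta> * ?a i l)"
    by (intro sum.cong refl) (auto simp: algebra_simps)
  also have "\<dots> = (\<sigma> + 1) * \<beta> * blk_inner b A u v - \<beta> * ((\<Sum>i\<in>UNIV. blk_cols b i A *v u) \<bullet> (\<Sum>i\<in>UNIV. blk_cols b i A *v v))"
    by (simp add: sum_subtractf blk_inner_def sum_distrib_left inner_sum_left inner_sum_right)
      (rule sum.swap)
  finally show ?thesis
    by (simp add: blk_cols_sum[of A _ b, symmetric])
qed

section \<open>First-order conditions of the block subproblems\<close>

text \<open>Compare \<open>u\<close> with a point at parameter \<open>t\<close> on the segment to
  \<open>v\<close>, bound \<open>f\<close> there by its chord, divide by \<open>t\<close> and let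
  \<open>t\<close> tend to 0 from the right: the quadratic coefficient \<open>b\<close> disappears.
  No derivative of \<open>f\<close> occurs; \<open>a\<close> is the slope of the smooth part at
  \<open>u\<close>.\<close>

lemma is_arg_min_convex_quadratic:
  fixes f :: "'a::real_vector \<Rightarrow> real"
  assumes "convex_on S f" "X \<subseteq> S" "convex X"
    and min: "is_arg_min F (\<lambda>z. z \<in> X) u" and v: "v \<in> X"
    and F: "\<And>t. 0 \<le> t \<Longrightarrow> t \<le> 1 \<Longrightarrow> F (u + t *\<^sub>R (v - u)) = f (u + t *\<^sub>R (v - u)) + K + t * a + t\<^sup>2 * b"
  shows "0 \<le> f v - f u + a"
proof -
  have u: "u \<in> X" using min by (simp add: is_arg_min_def)
  have *: "0 \<le> f v - f u + a + t * b" if t: "0 < t" "t \<le> 1" for t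
  proof -
    have eq: "u + t *\<^sub>R (v - u) = (1 - t) *\<^sub>R u + t *\<^sub>R v"
      by (simp add: algebra_simps)
    have "u + t *\<^sub>R (v - u) \<in> X"
      unfolding eq using assms(3) u v t by (intro convexD) auto
    then have "F u \<le> F (u + t *\<^sub>R (v - u))"
      using min by (auto simp: is_arg_min_linorder)
    moreover have "F u = f u + K"
      using F[of 0] by simp
    moreover have "f (u + t *\<^sub>R (v - u)) \<le> (1 - t) * f u + t * f v"
      unfolding eq using u v t by (intro convex_onD[OF convex_on_subset[OF assms(1-3)]]) auto
    ultimately have "0 \<le> t * (f v - f u + a + t * b)"
      using F[of t] t by (simp add: algebra_simps power2_eq_square)
    then show ?thesis
      using t by (simp add: zero_le_mult_iff)
  qed
  have "((\<lambda>t. f v - f u + a + t * b) \<longlongrightarrow> f v - f u + a + 0 * b) (at_right 0)"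
    by (intro tendsto_intros)
  moreover have "\<forall>\<^sub>F t in at_right 0. 0 \<le> f v - f u + a + t * b"
    unfolding eventually_at_right_field using * by (intro exI[of _ 1]) auto
  ultimately show ?thesis
    using tendsto_lowerbound[of _ _ "at_right (0::real)"] by fastforce
qed

text \<open>All blocks are updated from the same old point \<open>u\<close>, so the residual
  \<open>A *v u + e\<close> is common to the block conditions and they can be summed. In block i the
  penalty contributes \<beta> p_i and the proximal term \<sigma> \<beta> p_i, where p_i = A_i (u'_i
  - u_i); hence the factor \<open>\<sigma> + 1\<close>. The other group of variables enters through
  \<open>e\<close> and \<open>K\<close>, so the lemma serves both the x-step and the y-step.\<close>

lemma blk_argmin_variational:
  fixes b :: "'m::finite \<Rightarrow> 'p::finite" and A :: "real ^ 'm ^ 'n::finite"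
  assumes f: "\<And>i. convex_on (blk_space b i) (f i)"
    and X: "\<And>i. X i \<subseteq> blk_space b i" "\<And>i. convex (X i)"
    and min: "\<And>i. is_arg_min (F i) (\<lambda>z. z \<in> X i) (blk b i u')"
    and F: "\<And>i z. F i z = sep_sum b f (blk_upd b i z u) + K - l \<bullet> (A *v blk_upd b i z u + e)
        + \<beta> / 2 * (norm (A *v blk_upd b i z u + e))\<^sup>2
        + \<sigma> * \<beta> / 2 * (norm (blk_cols b i A *v (z - blk b i u)))\<^sup>2"
    and v: "v \<in> blk_prod b X"
  shows "0 \<le> sep_sum b f v - sep_sum b f u' + (\<beta> *\<^sub>R (A *v u + e) - l) \<bullet> (A *v (v - u'))
    + (\<sigma> + 1) * \<beta> * blk_inner b A (u' - u) (v - u')"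
proof -
  define p where "p i = blk_cols b i A *v (u' - u)" for i
  define q where "q i = blk_cols b i A *v (v - u')" for i
  have "0 \<le> f i (blk b i v) - f i (blk b i u') + ((\<beta> *\<^sub>R (A *v u + e) - l) \<bullet> q i + (\<sigma> + 1) * \<beta> * (p i \<bullet> q i))" for i
  proof (rule is_arg_min_convex_quadratic[OF f X min])
    let ?z = "\<lambda>t. blk b i u' + t *\<^sub>R (blk b i v - blk b i u')"
    let ?C = "\<Sum>j\<in>UNIV - {i}. f j (blk b j u)"
    show "blk b i v \<in> X i" using v by (simp add: blk_prod_def)
    fix t :: real
    have z: "?z t \<in> blk_space b i"
      by (simp add: blk_space_def blk_def)
    have 1: "blk_cols b i A *v (?z t - blk b i u) = p i + t *\<^sub>R q i"
      by (simp add: p_def q_def matrix_vector_mult_diff_distrib matrix_vector_right_distrib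
          matrix_vector_mult_scaleR blk_cols_mult_blk algebra_simps)
    have 2: "A *v blk_upd b i (?z t) u + e = (A *v u + e) + (p i + t *\<^sub>R q i)"
      unfolding blk_upd_eq[OF z]
      by (simp add: p_def q_def matrix_vector_mult_diff_distrib matrix_vector_right_distrib
          matrix_vector_mult_scaleR matrix_mult_blk algebra_simps)
    show "F i (?z t) = f i (?z t)
        + (?C + K - l \<bullet> (A *v u + e + p i) + \<beta> / 2 * (norm (A *v u + e + p i))\<^sup>2 + \<sigma> * \<beta> / 2 * (norm (p i))\<^sup>2)
        + t * ((\<beta> *\<^sub>R (A *v u + e) - l) \<bullet> q i + (\<sigma> + 1) * \<beta> * (p i \<bullet> q i))
        + t\<^sup>2 * ((\<sigma> + 1) * \<beta> / 2 * (norm (q i))\<^sup>2)"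
    proof -
      define R where "R = A *v u + e"
      have "(norm (w + t *\<^sub>R q i))\<^sup>2 = (norm w)\<^sup>2 + 2 * t * (w \<bullet> q i) + t\<^sup>2 * (norm (q i))\<^sup>2" for w
        unfolding power2_norm_eq_inner
        by (simp add: inner_add_left inner_add_right inner_commute[of "q i" w] power2_eq_square ring_distribs)
      note expand = this[of "R + p i"] this[of "p i"]
      show ?thesis
        unfolding F 1 2 sep_sum_blk_upd[OF z] R_def[symmetric] add.assoc[symmetric] expand
        by (simp add: inner_add_left inner_add_right inner_diff_left ring_distribs)
    qed
  qed
  then have "0 \<le> (\<Sum>i\<in>UNIV. f i (blk b i v) - f i (blk b i u') + ((\<beta> *\<^sub>R (A *v u + e) - l) \<bullet> q i + (\<sigma> + 1) * \<beta> * (p i \<bullet> q i)))"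
    by (rule sum_nonneg)
  also have "\<dots> = sep_sum b f v - sep_sum b f u' + ((\<beta> *\<^sub>R (A *v u + e) - l) \<bullet> (\<Sum>i\<in>UNIV. q i)
      + (\<sigma> + 1) * \<beta> * (\<Sum>i\<in>UNIV. p i \<bullet> q i))"
    by (simp add: sep_sum_def sum.distrib sum_subtractf inner_sum_right sum_distrib_left)
  also have "(\<Sum>i\<in>UNIV. q i) = A *v (v - u')"
    by (simp only: q_def blk_cols_sum[of A "v - u'" b])
  finally show ?thesis
    by (simp add: blk_inner_def p_def q_def)
qed

section \<open>Stacked vectors\<close>

lemma sum_UNIV_Plus:
  "(\<Sum>k\<in>(UNIV :: ('a::finite + 'b::finite) set). F k) = (\<Sum>a\<in>UNIV. F (Inl a)) + (\<Sum>b\<in>UNIV. F (Inr b))"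
  by (simp add: UNIV_Plus_UNIV[symmetric] sum.Plus del: UNIV_Plus_UNIV)

lemma inner_stack: "stack a b c \<bullet> stack a' b' c' = a \<bullet> a' + b \<bullet> b' + c \<bullet> c'"
  by (simp add: inner_vec_def sum_UNIV_Plus stack_def)

lemma stack_parts: "stack (xpart v) (ypart v) (lpart v) = v"
  by (simp add: stack_def xpart_def ypart_def lpart_def vec_eq_iff split: sum.split)

lemma parts_stack [simp]:
  "xpart (stack a b c) = a" "ypart (stack a b c) = b" "lpart (stack a b c) = c"
  by (simp_all add: stack_def xpart_def ypart_def lpart_def)

lemma stack_cases:
  obtains a b c where "v = stack a b c"
  using stack_parts[of v] by metis

lemma stack_diff: "stack a b c - stack a' b' c' = stack (a - a') (b - b') (c - c')"
  by (simp add: stack_def vec_eq_iff split: sum.split)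

lemma stack_eq_0_iff: "stack a b c = 0 \<longleftrightarrow> a = 0 \<and> b = 0 \<and> c = 0"
  by (auto simp: stack_def vec_eq_iff split: sum.splits)

lemma block3_mult_stack:
  "block3 P11 P12 P13 P21 P22 P23 P31 P32 P33 *v stack a b c =
     stack (P11 *v a + P12 *v b + P13 *v c) (P21 *v a + P22 *v b + P23 *v c) (P31 *v a + P32 *v b + P33 *v c)"
  by (simp add: vec_eq_iff matrix_vector_mult_def sum_UNIV_Plus block3_def stack_def split: sum.split)

lemma mat_mult_eq_scaleR: "mat k *v (v :: real ^ 'n::finite) = k *\<^sub>R v"
  by (simp add: vec_eq_iff matrix_vector_mult_def mat_def if_distrib if_distribR cong: if_cong)

lemma matrix_mult_uminus_left: "(- A) *v v = - (A *v (v :: real ^ 'n::finite))"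
  by (simp add: vec_eq_iff matrix_vector_mult_def sum_negf)

lemma matrix_mult_scaleR_left: "(r *\<^sub>R A) *v v = r *\<^sub>R (A *v (v :: real ^ 'n::finite))"
  by (simp add: scaleR_matrix_vector_assoc)

lemma Mmat_mult_stack: "Mmat B \<beta> \<tau> s *v stack a b e = stack a b ((\<tau> + s) *\<^sub>R e - (s * \<beta>) *\<^sub>R (B *v b))"
  by (simp add: Mmat_def block3_mult_stack mat_mult_eq_scaleR matrix_mult_uminus_left matrix_mult_scaleR_left)

lemma Qmat_mult_stack:
  "Qmat bx cy A B \<beta> \<sigma>\<^sub>1 \<sigma>\<^sub>2 \<tau> *v stack a b e =
     stack (Hx bx A \<beta> \<sigma>\<^sub>1 *v a) (((\<sigma>\<^sub>2 + 1) * \<beta>) *\<^sub>R (DB cy B *v b) - \<tau> *\<^sub>R (transpose B *v e))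
       ((1 / \<beta>) *\<^sub>R e - B *v b)"
  by (simp add: Qmat_def block3_mult_stack mat_mult_eq_scaleR matrix_mult_uminus_left matrix_mult_scaleR_left)

text \<open>The constant \<open>c\<close> drops out of the difference, and the transposed blocks
  carry the opposite sign of \<open>A\<close> and \<open>B\<close>.\<close>

lemma Jmap_skew: "(u - v) \<bullet> (Jmap A B c u - Jmap A B c v) = 0"
proof (cases u rule: stack_cases)
  case (1 a b e)
  show ?thesis
  proof (cases v rule: stack_cases)
    case (1 a' b' e')
    then show ?thesis
      unfolding \<open>u = stack a b e\<close>
      by (simp add: Jmap_def stack_diff inner_stack inner_diff inner_add inner_vector_matrix_mult
          matrix_vector_mult_diff_distrib inner_commute algebra_simps)
  qed
qed

text \<open>The matrix is block lower triangular with diagonal blocks I, I and (\<tau> + s) I, so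
  its kernel is trivial.\<close>

lemma invertible_Mmat:
  assumes "\<tau> + s \<noteq> 0"
  shows "invertible (Mmat B \<beta> \<tau> s :: real ^ ('m::finite + 'd::finite + 'n::finite) ^ ('m + 'd + 'n))"
proof -
  have "v = 0" if "Mmat B \<beta> \<tau> s *v v = 0" for v :: "real ^ ('m + 'd + 'n)"
    using that assms by (cases v rule: stack_cases) (auto simp: Mmat_mult_stack stack_eq_0_iff)
  then show ?thesis
    by (simp add: invertible_left_inverse matrix_left_invertible_ker)
qed

section \<open>The quadratic forms of Q and M^T Q\<close>

lemma inner_Qmat:
  "stack a b e \<bullet> (Qmat bx cy A B \<beta> \<sigma>\<^sub>1 \<sigma>\<^sub>2 \<tau> *v stack a' b' e') =
     a \<bullet> (Hx bx A \<beta> \<sigma>\<^sub>1 *v a') + (\<sigma>\<^sub>2 + 1) * \<beta> * blk_inner cy B b b' - \<tau> * ((B *v b) \<bullet> e')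
       + e \<bullet> e' / \<beta> - e \<bullet> (B *v b')"
  by (simp add: Qmat_mult_stack inner_stack inner_diff inner_DB inner_vector_matrix_mult)

text \<open>The unequal off-diagonal coefficients -\<tau> and -1 of Q both turn into -(\<tau> + s)
  in M^T Q; this is the source of the symmetry of H.\<close>

lemma inner_Mmat_Qmat:
  assumes "\<beta> > 0"
  shows "(Mmat B \<beta> \<tau> s *v stack a b e) \<bullet> (Qmat bx cy A B \<beta> \<sigma>\<^sub>1 \<sigma>\<^sub>2 \<tau> *v stack a' b' e') =
     a \<bullet> (Hx bx A \<beta> \<sigma>\<^sub>1 *v a') + (\<sigma>\<^sub>2 + 1) * \<beta> * blk_inner cy B b b' + s * \<beta> * ((B *v b) \<bullet> (B *v b'))
       - (\<tau> + s) * ((B *v b) \<bullet> e' + e \<bullet> (B *v b')) + (\<tau> + s) * (e \<bullet> e') / \<beta>"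
  using assms by (simp add: Mmat_mult_stack inner_Qmat inner_diff inner_add field_simps)

lemma Hx_psd:
  fixes b :: "'m::finite \<Rightarrow> 'p::finite"
  assumes "\<beta> > 0" "\<sigma> > real CARD('p) - 1"
  shows "0 \<le> a \<bullet> (Hx b A \<beta> \<sigma> *v a)"
proof -
  have "(A *v a) \<bullet> (A *v a) \<le> real CARD('p) * blk_inner b A a a"
    by (rule norm_matrix_le_blk_inner)
  also have "\<dots> \<le> (\<sigma> + 1) * blk_inner b A a a"
    using assms by (intro mult_right_mono blk_inner_nonneg) auto
  finally have "0 \<le> \<beta> * ((\<sigma> + 1) * blk_inner b A a a - (A *v a) \<bullet> (A *v a))"
    using assms by simp
  then show ?thesis
    by (simp add: inner_Hx algebra_simps)
qed

text \<open>With p = B b, the form splits into four nonnegative terms: the \<open>Hx\<close> part,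
  \<beta> times the surplus of (\<sigma>2 + 1) D over |p|^2, (1 - \<tau>) \<beta> |p|^2, and the
  square (\<tau> + s) |\<beta> p - e|^2 / \<beta>.\<close>

lemma Mmat_Qmat_psd:
  fixes bx :: "'m::finite \<Rightarrow> 'p::finite" and cy :: "'d::finite \<Rightarrow> 'q::finite"
  assumes "\<beta> > 0" "\<sigma>\<^sub>1 > real CARD('p) - 1" "\<sigma>\<^sub>2 > real CARD('q) - 1" "\<tau> < 1" "\<tau> + s > 0"
  shows "0 \<le> (Mmat B \<beta> \<tau> s *v v) \<bullet> (Qmat bx cy A B \<beta> \<sigma>\<^sub>1 \<sigma>\<^sub>2 \<tau> *v v)"
proof (cases v rule: stack_cases)
  case (1 a b e)
  let ?p = "B *v b" and ?D = "blk_inner cy B b b"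
  have "?p \<bullet> ?p \<le> real CARD('q) * ?D"
    by (rule norm_matrix_le_blk_inner)
  also have "\<dots> \<le> (\<sigma>\<^sub>2 + 1) * ?D"
    using assms by (intro mult_right_mono blk_inner_nonneg) auto
  finally have "0 \<le> \<beta> * ((\<sigma>\<^sub>2 + 1) * ?D - ?p \<bullet> ?p)"
    using assms by simp
  moreover have "0 \<le> (1 - \<tau>) * \<beta> * (?p \<bullet> ?p)"
    using assms by simp
  moreover have "0 \<le> (\<tau> + s) * ((\<beta> *\<^sub>R ?p - e) \<bullet> (\<beta> *\<^sub>R ?p - e)) / \<beta>"
    using assms by simp
  moreover have "(\<tau> + s) * ((\<beta> *\<^sub>R ?p - e) \<bullet> (\<beta> *\<^sub>R ?p - e)) / \<beta>
      = (\<tau> + s) * \<beta> * (?p \<bullet> ?p) - (\<tau> + s) * (?p \<bullet> e + e \<bullet> ?p) + (\<tau> + s) * (e \<bullet> e) / \<beta>"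
    using assms by (simp add: inner_diff field_simps)
  moreover have "0 \<le> a \<bullet> (Hx bx A \<beta> \<sigma>\<^sub>1 *v a)"
    using assms by (intro Hx_psd)
  ultimately show ?thesis
    unfolding 1 inner_Mmat_Qmat[OF \<open>\<beta> > 0\<close>]
    by (simp only: left_diff_distrib right_diff_distrib distrib_right distrib_left mult.assoc mult.left_commute mult_1)
qed

text \<open>Both forms are compared with h + D + E, the sum of the \<open>Hx\<close> part, the
  scaled block form of \<open>B\<close> and the scaled multiplier part: G is at least \<delta> times
  this sum and M^T Q at most \<open>C\<close> times it, so \<xi> = \<delta> / C works.\<close>

lemma Gmat_dominates:
  fixes bx :: "'m::finite \<Rightarrow> 'p::finite" and cy :: "'d::finite \<Rightarrow> 'q::finite"
  assumes "\<beta> > 0" "\<sigma>\<^sub>1 > real CARD('p) - 1" "\<sigma>\<^sub>2 > real CARD('q) - 1" "\<tau> < 1" "s < 1" "\<tau> + s > 0"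
  shows "\<exists>\<xi>>0. \<forall>v. \<xi> * ((Mmat B \<beta> \<tau> s *v v) \<bullet> (Qmat bx cy A B \<beta> \<sigma>\<^sub>1 \<sigma>\<^sub>2 \<tau> *v v))
      \<le> 2 * (v \<bullet> (Qmat bx cy A B \<beta> \<sigma>\<^sub>1 \<sigma>\<^sub>2 \<tau> *v v))
        - (Mmat B \<beta> \<tau> s *v v) \<bullet> (Qmat bx cy A B \<beta> \<sigma>\<^sub>1 \<sigma>\<^sub>2 \<tau> *v v)"
proof -
  define q where "q = real CARD('q)"
  \<comment> \<open>The least of the coefficients that h, D and E keep in the lower bound for
    G.\<close>
  define \<delta> where "\<delta> = min 1 (min (\<sigma>\<^sub>2 + 1 - q) (1 - \<tau>))"
  \<comment> \<open>\<open>Z\<close> is the weight that the indefinite terms s P and -2 (\<tau> + s)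
    r put on D; \<open>C\<close> then dominates all three coefficients in the upper bound.\<close>
  define Z where "Z = (\<bar>s\<bar> + (\<tau> + s)) * q"
  define C where "C = 1 + (\<sigma>\<^sub>2 + 1) + Z + 2 * (\<tau> + s)"
  have q: "0 < q" "q < \<sigma>\<^sub>2 + 1" using assms by (auto simp: q_def)
  have \<delta>: "0 < \<delta>" "\<delta> \<le> 1" "\<delta> \<le> \<sigma>\<^sub>2 + 1 - q" "\<delta> \<le> 1 - \<tau>"
    using q assms by (auto simp: \<delta>_def)
  have Z: "0 \<le> Z" using q assms by (simp add: Z_def)
  have Cge: "1 \<le> C" "\<sigma>\<^sub>2 + 1 + Z \<le> C" "2 * (\<tau> + s) \<le> C"
    using Z q assms(6) by (simp_all add: C_def)
  then have C: "0 < C" by simp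
  have "\<delta> / C * ((Mmat B \<beta> \<tau> s *v v) \<bullet> (Qmat bx cy A B \<beta> \<sigma>\<^sub>1 \<sigma>\<^sub>2 \<tau> *v v))
      \<le> 2 * (v \<bullet> (Qmat bx cy A B \<beta> \<sigma>\<^sub>1 \<sigma>\<^sub>2 \<tau> *v v))
        - (Mmat B \<beta> \<tau> s *v v) \<bullet> (Qmat bx cy A B \<beta> \<sigma>\<^sub>1 \<sigma>\<^sub>2 \<tau> *v v)" (is "_ / _ * ?N \<le> ?G") for v
  proof (cases v rule: stack_cases)
    case (1 a b e)
    let ?p = "B *v b"
    define h where "h = a \<bullet> (Hx bx A \<beta> \<sigma>\<^sub>1 *v a)"
    define D where "D = \<beta> * blk_inner cy B b b"
    define P where "P = \<beta> * (?p \<bullet> ?p)"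
    define r where "r = ?p \<bullet> e"
    define E where "E = (e \<bullet> e) / \<beta>"
    have nonneg: "0 \<le> h" "0 \<le> D" "0 \<le> P" "0 \<le> E"
      using assms by (auto simp: h_def D_def P_def E_def Hx_psd blk_inner_nonneg)
    have PD: "P \<le> q * D"
      using mult_left_mono[OF norm_matrix_le_blk_inner[of B b cy], of \<beta>] assms
      by (simp add: P_def D_def q_def algebra_simps)
    \<comment> \<open>The two signs bound the cross term r on both sides: the first serves the lower
      bound for G, the second the upper bound for M^T Q.\<close>
    have "0 \<le> (\<beta> *\<^sub>R ?p - e) \<bullet> (\<beta> *\<^sub>R ?p - e) / \<beta>" "0 \<le> (\<beta> *\<^sub>R ?p + e) \<bullet> (\<beta> *\<^sub>R ?p + e) / \<beta>"
      using assms by auto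
    moreover have "(\<beta> *\<^sub>R ?p - e) \<bullet> (\<beta> *\<^sub>R ?p - e) / \<beta> = P - 2 * r + E"
      "(\<beta> *\<^sub>R ?p + e) \<bullet> (\<beta> *\<^sub>R ?p + e) / \<beta> = P + 2 * r + E"
      using assms by (simp_all add: P_def r_def E_def inner_diff inner_add inner_commute field_simps)
    ultimately have sq: "0 \<le> P - 2 * r + E" "0 \<le> P + 2 * r + E" by auto
    have N: "?N = h + (\<sigma>\<^sub>2 + 1) * D + s * P - 2 * (\<tau> + s) * r + (\<tau> + s) * E"
      unfolding 1 inner_Mmat_Qmat[OF \<open>\<beta> > 0\<close>]
      by (simp add: h_def D_def P_def r_def E_def inner_commute)
    have "v \<bullet> (Qmat bx cy A B \<beta> \<sigma>\<^sub>1 \<sigma>\<^sub>2 \<tau> *v v) = h + (\<sigma>\<^sub>2 + 1) * D - (\<tau> + 1) * r + E"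
      unfolding 1 inner_Qmat
      by (simp add: h_def D_def r_def E_def inner_commute algebra_simps)
    \<comment> \<open>The cross term of G is -2 (1 - s) r. Completing it to a square uses (1 - s) P
      and (1 - s) E; the remaining -P is absorbed by q D, and E keeps the coefficient 1 -
      \<tau>.\<close>
    then have "?G = h + (\<sigma>\<^sub>2 + 1 - q) * D + (q * D - P) + (1 - s) * (P - 2 * r + E) + (1 - \<tau>) * E"
      unfolding N by (simp add: algebra_simps)
    moreover have "0 \<le> (1 - s) * (P - 2 * r + E)"
      using sq assms by simp
    moreover have "\<delta> * D \<le> (\<sigma>\<^sub>2 + 1 - q) * D" "\<delta> * E \<le> (1 - \<tau>) * E" "\<delta> * h \<le> 1 * h"
      by (rule mult_right_mono; fact)+
    ultimately have G: "\<delta> * (h + D + E) \<le> ?G"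
      using PD by (simp add: algebra_simps)
    \<comment> \<open>The stepsize \<open>s\<close> may be negative, hence the absolute
      value.\<close>
    have "s * P \<le> \<bar>s\<bar> * (q * D)"
      using PD nonneg by (intro mult_mono) auto
    moreover have "(\<tau> + s) * (- 2 * r) \<le> (\<tau> + s) * (q * D + E)"
      using sq PD assms by (intro mult_left_mono) auto
    ultimately have "?N \<le> h + (\<sigma>\<^sub>2 + 1 + Z) * D + 2 * (\<tau> + s) * E"
      unfolding N Z_def by (simp add: algebra_simps)
    also have "\<dots> \<le> C * h + C * D + C * E"
    proof -
      have "1 * h \<le> C * h" "(\<sigma>\<^sub>2 + 1 + Z) * D \<le> C * D" "2 * (\<tau> + s) * E \<le> C * E"
        by (rule mult_right_mono; fact)+
      then show ?thesis by simp
    qed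
    finally have "?N / C \<le> h + D + E"
      using C by (simp add: field_simps)
    then have "\<delta> * (?N / C) \<le> \<delta> * (h + D + E)"
      using \<delta> by (intro mult_left_mono) auto
    with G show ?thesis by simp
  qed
  then show ?thesis
    using \<delta> C by (intro exI[of _ "\<delta> / C"]) auto
qed

section \<open>GS-ADMM as an instance of the prediction-correction scheme\<close>

theorem theorem2p2:
  fixes bx :: "'m::finite \<Rightarrow> 'p::finite" and cy :: "'d::finite \<Rightarrow> 'q::finite"
    and f :: "'p \<Rightarrow> real ^ 'm \<Rightarrow> real" and g :: "'q \<Rightarrow> real ^ 'd \<Rightarrow> real"
    and A :: "real ^ 'm ^ 'n::finite" and B :: "real ^ 'd ^ 'n" and c :: "real ^ 'n"
    and X :: "'p \<Rightarrow> (real ^ 'm) set" and Y :: "'q \<Rightarrow> (real ^ 'd) set"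
    and \<beta> \<sigma>\<^sub>1 \<sigma>\<^sub>2 \<tau> s :: real
    and x :: "nat \<Rightarrow> real ^ 'm" and y :: "nat \<Rightarrow> real ^ 'd" and lh l :: "nat \<Rightarrow> real ^ 'n"
    and w wt :: "nat \<Rightarrow> real ^ ('m + 'd + 'n)"
  assumes f: "\<And>i. closed_proper_convex_on (blk_space bx i) (f i)"
    and g: "\<And>j. closed_proper_convex_on (blk_space cy j) (g j)"
    and X: "\<And>i. X i \<subseteq> blk_space bx i \<and> polyhedron (X i)"
    and Y: "\<And>j. Y j \<subseteq> blk_space cy j \<and> polyhedron (Y j)"
    and sol: "solution_set bx cy f g A B c X Y \<noteq> {}"
    and rank_A: "\<And>i. rank (blk_cols bx i A) = blk_size bx i"
    and rank_B: "\<And>j. rank (blk_cols cy j B) = blk_size cy j"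
    and beta: "\<beta> > 0"
    and sigma1: "\<sigma>\<^sub>1 > real CARD('p) - 1"
    and sigma2: "\<sigma>\<^sub>2 > real CARD('q) - 1"
    and D: "\<tau> < 1" "s < 1" "\<tau> + s > 0"
    and gs: "gs_admm bx cy f g A B c X Y \<beta> \<sigma>\<^sub>1 \<sigma>\<^sub>2 \<tau> s x y lh l"
    and w: "\<And>k. w k = stack (x k) (y k) (l k)"
    and wt: "\<And>k. wt k = stack (x (Suc k)) (y (Suc k)) (l k - \<beta> *\<^sub>R (A *v x (Suc k) + B *v y k - c))"
  shows "\<exists>\<xi>>0. \<forall>t::nat. t > 0 \<longrightarrow> (\<forall>ws \<in> Mstar bx cy f g A B c X Y.
           sqnorm (Hmat bx cy A B \<beta> \<sigma>\<^sub>1 \<sigma>\<^sub>2 \<tau> s) (Mmat B \<beta> \<tau> s *v (w t - wt t))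
             \<le> 1 / ((real t + 1) * \<xi>) * sqnorm (Hmat bx cy A B \<beta> \<sigma>\<^sub>1 \<sigma>\<^sub>2 \<tau> s) (w 0 - ws))"
proof -
  let ?Q = "Qmat bx cy A B \<beta> \<sigma>\<^sub>1 \<sigma>\<^sub>2 \<tau>" and ?M = "Mmat B \<beta> \<tau> s :: real ^ ('m + 'd + 'n) ^ ('m + 'd + 'n)"
  let ?h = "hfun bx cy f g :: real ^ ('m + 'd + 'n) \<Rightarrow> real" and ?J = "Jmap A B c"
  have convex: "\<And>i. convex_on (blk_space bx i) (f i)" "\<And>j. convex_on (blk_space cy j) (g j)"
      "\<And>i. X i \<subseteq> blk_space bx i" "\<And>j. Y j \<subseteq> blk_space cy j" "\<And>i. convex (X i)" "\<And>j. convex (Y j)"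
    using f g X Y by (auto simp: closed_proper_convex_on_def polyhedron_imp_convex)
  have minx: "is_arg_min
      (\<lambda>z. aug_lagr bx cy f g A B c \<beta> (blk_upd bx i z (x k)) (y k) (l k)
         + \<sigma>\<^sub>1 * \<beta> / 2 * (norm (blk_cols bx i A *v (z - blk bx i (x k))))\<^sup>2)
      (\<lambda>z. z \<in> X i) (blk bx i (x (Suc k)))" for i k
    using gs unfolding gs_admm_def by blast
  have miny: "is_arg_min
      (\<lambda>z. aug_lagr bx cy f g A B c \<beta> (x (Suc k)) (blk_upd cy j z (y k)) (lh k)
         + \<sigma>\<^sub>2 * \<beta> / 2 * (norm (blk_cols cy j B *v (z - blk cy j (y k))))\<^sup>2)
      (\<lambda>z. z \<in> Y j) (blk cy j (y (Suc k)))" for j k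
    using gs unfolding gs_admm_def by blast
  have lh: "lh k = l k - (\<tau> * \<beta>) *\<^sub>R (A *v x (Suc k) + B *v y k - c)" for k
    using gs unfolding gs_admm_def by blast
  have lSuc: "l (Suc k) = lh k - (s * \<beta>) *\<^sub>R (A *v x (Suc k) + B *v y (Suc k) - c)" for k
    using gs unfolding gs_admm_def by blast
  have wtS: "wt k \<in> Mset bx cy X Y" for k
    using minx miny by (simp add: Mset_def wt blk_prod_def is_arg_min_def)
  \<comment> \<open>With r the residual at (x^{k+1}, y^k), the two multiplier updates add up to
    -(\<tau> + s) \<beta> r + s \<beta> B (y^k - y^{k+1}), and \<beta> r is the multiplier part of
    \<open>w k - wt k\<close>.\<close>
  have step: "w (Suc k) = w k - ?M *v (w k - wt k)" for k
    by (simp add: w wt stack_diff Mmat_mult_stack lSuc lh matrix_vector_mult_diff_distrib algebra_simps)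
  have pred: "?h v - ?h (wt k) + (v - wt k) \<bullet> ?J (wt k) \<ge> (v - wt k) \<bullet> (?Q *v (w k - wt k))"
    if v: "v \<in> Mset bx cy X Y" for k v
  proof (cases v rule: stack_cases)
    case (1 a b e)
    define r where "r = A *v x (Suc k) + B *v y k - c"
    have ab: "a \<in> blk_prod bx X" "b \<in> blk_prod cy Y"
      using v by (simp_all add: Mset_def 1)
    have "0 \<le> sep_sum bx f a - sep_sum bx f (x (Suc k))
        + (\<beta> *\<^sub>R (A *v x k + (B *v y k - c)) - l k) \<bullet> (A *v (a - x (Suc k)))
        + (\<sigma>\<^sub>1 + 1) * \<beta> * blk_inner bx A (x (Suc k) - x k) (a - x (Suc k))"
      by (rule blk_argmin_variational[OF convex(1,3,5) minx _ ab(1), where K = "sep_sum cy g (y k)"])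
        (simp add: aug_lagr_def algebra_simps)
    \<comment> \<open>Moving the residual from x^k to x^{k+1} subtracts \<beta> A^T A from the block
      diagonal term, which leaves exactly \<open>Hx\<close>.\<close>
    moreover have "A *v x k + (B *v y k - c) = r - A *v (x (Suc k) - x k)"
      by (simp add: r_def matrix_vector_mult_diff_distrib)
    ultimately have VIx: "0 \<le> sep_sum bx f a - sep_sum bx f (x (Suc k))
        + (\<beta> *\<^sub>R r - l k) \<bullet> (A *v (a - x (Suc k)))
        + (a - x (Suc k)) \<bullet> (Hx bx A \<beta> \<sigma>\<^sub>1 *v (x (Suc k) - x k))"
      by (simp add: inner_Hx blk_inner_commute[of bx A "a - _"] inner_commute[of "A *v (a - _)"]
          inner_diff_left right_diff_distrib)
    have "0 \<le> sep_sum cy g b - sep_sum cy g (y (Suc k))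
        + (\<beta> *\<^sub>R (B *v y k + (A *v x (Suc k) - c)) - lh k) \<bullet> (B *v (b - y (Suc k)))
        + (\<sigma>\<^sub>2 + 1) * \<beta> * blk_inner cy B (y (Suc k) - y k) (b - y (Suc k))"
      by (rule blk_argmin_variational[OF convex(2,4,6) miny _ ab(2), where K = "sep_sum bx f (x (Suc k))"])
        (simp add: aug_lagr_def algebra_simps)
    \<comment> \<open>The half-step multiplier contributes the extra \<tau> \<beta> r, which becomes
      the entry -\<tau> B^T of Q.\<close>
    moreover have "\<beta> *\<^sub>R (B *v y k + (A *v x (Suc k) - c)) - lh k = (\<beta> *\<^sub>R r - l k) + (\<tau> * \<beta>) *\<^sub>R r"
      by (simp add: r_def lh algebra_simps)
    ultimately have VIy: "0 \<le> sep_sum cy g b - sep_sum cy g (y (Suc k))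
        + (\<beta> *\<^sub>R r - l k) \<bullet> (B *v (b - y (Suc k))) + \<tau> * \<beta> * (r \<bullet> (B *v (b - y (Suc k))))
        + (\<sigma>\<^sub>2 + 1) * \<beta> * blk_inner cy B (b - y (Suc k)) (y (Suc k) - y k)"
      by (simp add: inner_add_left blk_inner_commute[of cy B "b - _"])
    let ?e = "e - (l k - \<beta> *\<^sub>R r)"
    \<comment> \<open>The multiplier row of the prediction inequality holds with equality: the
      right-hand side is the last row of Q applied to \<open>w k - wt k\<close>.\<close>
    have lam: "?e \<bullet> (A *v x (Suc k) + B *v y (Suc k) - c) = ?e \<bullet> r - ?e \<bullet> (B *v (y k - y (Suc k)))"
    proof -
      have "A *v x (Suc k) + B *v y (Suc k) - c = r - B *v (y k - y (Suc k))"
        by (simp add: r_def matrix_vector_mult_diff_distrib)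
      then show ?thesis by (simp only: inner_diff_right)
    qed
    \<comment> \<open>The block conditions contain new minus old iterates, whereas Q acts on old
      minus new.\<close>
    have Hneg: "u \<bullet> (Hx bx A \<beta> \<sigma>\<^sub>1 *v (p - p')) = - (u \<bullet> (Hx bx A \<beta> \<sigma>\<^sub>1 *v (p' - p)))" for u p p'
      by (simp add: matrix_vector_mult_diff_distrib inner_diff_right)
    have Dneg: "blk_inner cy B u (p - p') = - blk_inner cy B u (p' - p)" for u p p'
      by (simp add: inner_DB[symmetric] matrix_vector_mult_diff_distrib inner_diff_right)
    have wt': "wt k = stack (x (Suc k)) (y (Suc k)) (l k - \<beta> *\<^sub>R r)"
      by (simp add: wt r_def)
    have "(v - wt k) \<bullet> (?Q *v (w k - wt k)) =
        - ((a - x (Suc k)) \<bullet> (Hx bx A \<beta> \<sigma>\<^sub>1 *v (x (Suc k) - x k)))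
        - (\<sigma>\<^sub>2 + 1) * \<beta> * blk_inner cy B (b - y (Suc k)) (y (Suc k) - y k)
        - \<tau> * \<beta> * (r \<bullet> (B *v (b - y (Suc k)))) + ?e \<bullet> r - ?e \<bullet> (B *v (y k - y (Suc k)))"
      unfolding 1 wt' w stack_diff inner_Qmat Hneg[of _ "x k"] Dneg[of _ "y k"]
      using beta by (simp add: inner_commute)
    moreover have "(v - wt k) \<bullet> ?J (wt k) =
        (\<beta> *\<^sub>R r - l k) \<bullet> (A *v (a - x (Suc k))) + (\<beta> *\<^sub>R r - l k) \<bullet> (B *v (b - y (Suc k)))
        + ?e \<bullet> (A *v x (Suc k) + B *v y (Suc k) - c)"
      unfolding 1 wt' Jmap_def stack_diff inner_stack parts_stack inner_minus_right
        transpose_matrix_vector inner_vector_matrix_mult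
      by (simp add: inner_diff_left inner_diff_right inner_commute)
    moreover have "?h v - ?h (wt k) = sep_sum bx f a - sep_sum bx f (x (Suc k))
        + (sep_sum cy g b - sep_sum cy g (y (Suc k)))"
      by (simp add: hfun_def 1 wt')
    ultimately show ?thesis
      using VIx VIy lam by linarith
  qed
  have sym: "(?M *v u) \<bullet> (?Q *v v) = (?M *v v) \<bullet> (?Q *v u)" for u v
  proof (cases u rule: stack_cases)
    case (1 a b e)
    show ?thesis
    proof (cases v rule: stack_cases)
      case (1 a' b' e')
      have "a \<bullet> (Hx bx A \<beta> \<sigma>\<^sub>1 *v a') = a' \<bullet> (Hx bx A \<beta> \<sigma>\<^sub>1 *v a)"
        by (simp add: inner_Hx blk_inner_commute inner_commute)
      then show ?thesis
        unfolding 1 \<open>u = stack a b e\<close> inner_Mmat_Qmat[OF beta]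
        by (simp add: blk_inner_commute[of cy B b] inner_commute algebra_simps)
    qed
  qed
  \<comment> \<open>The constant is fixed before \<open>t\<close> and \<open>ws\<close>, so it is
    uniform in both.\<close>
  obtain \<xi> where xi: "\<xi> > 0" "\<And>v. \<xi> * ((?M *v v) \<bullet> (?Q *v v)) \<le> 2 * (v \<bullet> (?Q *v v)) - (?M *v v) \<bullet> (?Q *v v)"
    using Gmat_dominates[OF beta sigma1 sigma2 D] by blast
  have inv: "invertible ?M"
    using D by (intro invertible_Mmat) auto
  have "sqnorm (Hmat bx cy A B \<beta> \<sigma>\<^sub>1 \<sigma>\<^sub>2 \<tau> s) (?M *v (w t - wt t))
      \<le> 1 / ((real t + 1) * \<xi>) * sqnorm (Hmat bx cy A B \<beta> \<sigma>\<^sub>1 \<sigma>\<^sub>2 \<tau> s) (w 0 - ws)"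
    if ws: "ws \<in> Mstar bx cy f g A B c X Y" for t ws
  proof -
    \<comment> \<open>\<open>Mstar\<close> is an intersection over \<open>Mset\<close>, so
      \<open>ws\<close> inherits membership in \<open>Mset\<close> only because that index set is
      nonempty; the predictors \<open>wt k\<close> witness this.\<close>
    have ws': "ws \<in> Mset bx cy X Y"
      "\<And>v. v \<in> Mset bx cy X Y \<Longrightarrow> ?h v - ?h ws + (v - ws) \<bullet> ?J v \<ge> 0"
      using ws wtS by (auto simp: Mstar_def)
    show ?thesis
      unfolding Hmat_def
      by (rule prediction_correction_rate[where Q = ?Q and M = ?M and w = w and wt = wt and
            S = "Mset bx cy X Y" and h = ?h and J = ?J, OF inv sym Mmat_Qmat_psd[OF beta sigma1 sigma2 D(1,3)]
            xi Jmap_skew pred wtS step ws'])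
  qed
  with xi(1) show ?thesis by blast
qed

end
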